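(* Let $n_1,n_2$ be integers with $1<n_i\le m$ for $i\in\{1,2\}$, and suppose that a $((n_1,n_2),(1,1))$-MRD code exists in $\mathbb{F}_{q^m}^{n_1+n_2}$. Then $n_i\le m/2$ for every $i\in\{1,2\}$. Moreover: if $n_1=n_2$, then $m\ge n_1+n_2$, with equality if and only if $n_1=n_2=m/2$; if $n_1\ne n_2$, then $m\ge n_1+n_2+1$.
   Context: An $[n,k]_{q^m/q}$ code is a $k$-dim $\mathbb{F}_{q^m}$-subspace of $\mathbb{F}_{q^m}^n$ with rank weight $w(v)=\dim_{\mathbb{F}_q}\langle v_1,\dots,v_n\rangle_{\mathbb{F}_q}$. For $n_i\le m$, an $[n_i,1]_{q^m/q}$ code is MRD if its minimum distance is $n_i$. A $((n_1,n_2),(1,1))$-MRD code is an $[n_1+n_2,2]_{q^m/q}$ code $\mathcal{C}=\mathcal{C}_1\oplus\mathcal{C}_2=\{(c_1,c_2):c_i\in\mathcal{C}_i\}$ with $\mathcal{C}_i\subseteq\mathbb{F}_{q^m}^{n_i}$ MRD codes of parameters $[n_i,1]_{q^m/q}$, such that every codeword $(c_1,c_2)$ with $c_1\ne0$ and $c_2\ne0$ has rank weight at least $n_1+n_2-1$. *)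

theory Defs
  imports Complex_Main "HOL-Library.Cardinality" "Jordan_Normal_Form.VS_Connect"
begin

text \<open>The extension of finite fields with \<open>q\<^sup>m\<close> and \<open>q\<close> elements is given by two finite field
  types \<open>'a\<close> and \<open>'q\<close> and an embedding \<open>h :: 'q \<Rightarrow> 'a\<close>; the larger field becomes a vector space
  over the smaller one by \<open>c \<cdot> x = h c * x\<close>.\<close>

definition base_scale :: "('q::field \<Rightarrow> 'a::field) \<Rightarrow> 'q \<Rightarrow> 'a \<Rightarrow> 'a" where
  "base_scale h c x = h c * x"

definition rank_weight :: "('q::field \<Rightarrow> 'a::field) \<Rightarrow> 'a vec \<Rightarrow> nat" where
  "rank_weight h v =
     vector_space.dim (base_scale h) (Modules.module.span (base_scale h) (set\<^sub>v v))"

definition linear_code :: "nat \<Rightarrow> nat \<Rightarrow> 'a::field vec set \<Rightarrow> bool" where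
  "linear_code n k C \<longleftrightarrow>
     VectorSpace.subspace class_ring C (module_vec TYPE('a) n) \<and>
     vectorspace.dim class_ring ((module_vec TYPE('a) n)\<lparr>carrier := C\<rparr>) = k"

definition min_distance :: "('q::field \<Rightarrow> 'a::field) \<Rightarrow> 'a vec set \<Rightarrow> nat" where
  "min_distance h C = Min {rank_weight h (u - v) | u v. u \<in> C \<and> v \<in> C \<and> u \<noteq> v}"

definition mrd_code_dim1 :: "('q::field \<Rightarrow> 'a::field) \<Rightarrow> nat \<Rightarrow> 'a vec set \<Rightarrow> bool" where
  "mrd_code_dim1 h n C \<longleftrightarrow> linear_code n 1 C \<and> min_distance h C = n"

definition mrd_code_11 :: "('q::field \<Rightarrow> 'a::field) \<Rightarrow> nat \<Rightarrow> nat \<Rightarrow> 'a vec set \<Rightarrow> bool" where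
  "mrd_code_11 h n1 n2 C \<longleftrightarrow>
     linear_code (n1 + n2) 2 C \<and>
     (\<exists>C1 C2. mrd_code_dim1 h n1 C1 \<and> mrd_code_dim1 h n2 C2 \<and>
        C = {c1 @\<^sub>v c2 | c1 c2. c1 \<in> C1 \<and> c2 \<in> C2} \<and>
        (\<forall>c1\<in>C1. \<forall>c2\<in>C2. c1 \<noteq> 0\<^sub>v n1 \<longrightarrow> c2 \<noteq> 0\<^sub>v n2 \<longrightarrow>
           n1 + n2 - 1 \<le> rank_weight h (c1 @\<^sub>v c2)))"

end

theory Submission
  imports Defs
begin

text \<open>Let \<open>S\<close> and \<open>T\<close> be the entry sets of nonzero codewords of the two component codes, and let
  \<open>V\<close> be the \<open>\<F>\<^sub>q\<close>-span of \<open>T\<close>, of dimension \<open>n\<^sub>2\<close>. Choose distinct nonzero \<open>u\<^sub>1, u\<^sub>2 \<in> S\<close>. A relation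
  \<open>u\<^sub>1 v = u\<^sub>2 w\<close> with nonzero \<open>v, w \<in> V\<close> would put both \<open>u\<^sub>1\<close> and \<open>u\<^sub>2\<close> into \<open>\<lambda> V\<close> for
  \<open>\<lambda> = u\<^sub>1 / w = u\<^sub>2 / v\<close>, so that the codeword with entries \<open>S \<union> \<lambda> T\<close> would have rank weight at most
  \<open>n\<^sub>1 + n\<^sub>2 - 2\<close>. Hence \<open>u\<^sub>1 V \<inter> u\<^sub>2 V = 0\<close> and \<open>2 n\<^sub>2 \<le> m\<close>; by symmetry \<open>2 n\<^sub>1 \<le> m\<close>. The remaining
  inequalities are arithmetic consequences of these two.\<close>

section \<open>Counting the elements of a span\<close>

lemma (in vector_space) card_span_independent:
  assumes "finite B" and ind: "independent B"
  shows "card (span B) = CARD('a) ^ card B"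
proof -
  let ?f = "\<lambda>c. \<Sum>b\<in>B. scale (c b) b"
  \<comment> \<open>Coordinates over \<open>B\<close> are unique by independence. Extensional
    functions represent each coordinate tuple exactly once, hence \<open>restrict\<close>
    below.\<close>
  have inj: "inj_on ?f (B \<rightarrow>\<^sub>E UNIV)"
  proof (rule inj_onI)
    fix c d assume c: "c \<in> B \<rightarrow>\<^sub>E UNIV" and d: "d \<in> B \<rightarrow>\<^sub>E UNIV" and eq: "?f c = ?f d"
    have "(\<Sum>b\<in>B. scale (c b - d b) b) = 0"
      using eq by (simp add: scale_left_diff_distrib sum_subtractf)
    then have "c b - d b = 0" if "b \<in> B" for b
      using independentD[OF ind \<open>finite B\<close> subset_refl, of "\<lambda>b. c b - d b" b] that by blast
    then show "c = d" using PiE_ext[OF c d] by simp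
  qed
  have "span B = ?f ` (B \<rightarrow>\<^sub>E UNIV)"
  proof
    show "span B \<subseteq> ?f ` (B \<rightarrow>\<^sub>E UNIV)"
    proof
      fix x assume "x \<in> span B"
      then obtain u where "x = ?f u" using span_finite[OF \<open>finite B\<close>] by auto
      then have "x = ?f (restrict u B)" by (simp cong: sum.cong)
      moreover have "restrict u B \<in> B \<rightarrow>\<^sub>E UNIV" by simp
      ultimately show "x \<in> ?f ` (B \<rightarrow>\<^sub>E UNIV)" by blast
    qed
  qed (use span_finite[OF \<open>finite B\<close>] in auto)
  then show ?thesis using card_image[OF inj] card_funcsetE[OF \<open>finite B\<close>, of UNIV] by simp
qed

lemma (in vector_space) card_span:
  assumes "finite T"
  shows "card (span T) = CARD('a) ^ dim T"
proof -
  obtain B where B: "B \<subseteq> T" "independent B" "T \<subseteq> span B" "card B = dim T"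
    by (rule basis_exists)
  then have "span B = span T" by (metis span_mono span_span subset_antisym)
  moreover have "finite B" using B(1) assms finite_subset by blast
  ultimately show ?thesis using card_span_independent[of B] B by simp
qed

section \<open>Entry sets of scaled and concatenated vectors\<close>

lemma vec_set_smult: "set\<^sub>v (a \<cdot>\<^sub>v v) = (*) a ` set\<^sub>v v"
  by (auto simp: vec_set_def image_image)

lemma vec_set_append: "set\<^sub>v (v @\<^sub>v w) = set\<^sub>v v \<union> set\<^sub>v w"
proof
  show "set\<^sub>v (v @\<^sub>v w) \<subseteq> set\<^sub>v v \<union> set\<^sub>v w"
    by (force simp: vec_set_def)
  show "set\<^sub>v v \<union> set\<^sub>v w \<subseteq> set\<^sub>v (v @\<^sub>v w)"
  proof
    fix x assume "x \<in> set\<^sub>v v \<union> set\<^sub>v w"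
    then show "x \<in> set\<^sub>v (v @\<^sub>v w)"
    proof
      assume "x \<in> set\<^sub>v v"
      then obtain i where "v $ i = x" "i < dim_vec v" by (rule vec_setE)
      then show ?thesis by (intro vec_setI[of _ i]) auto
    next
      assume "x \<in> set\<^sub>v w"
      then obtain i where "w $ i = x" "i < dim_vec w" by (rule vec_setE)
      then show ?thesis by (intro vec_setI[of _ "dim_vec v + i"]) auto
    qed
  qed
qed

lemma finite_vec_set: "finite (set\<^sub>v v)"
  by (simp add: vec_set_def)

lemma card_vec_set_le: "card (set\<^sub>v v) \<le> dim_vec v"
  using card_image_le[of "{..<dim_vec v}" "($) v"] by (simp add: vec_set_def)

section \<open>The larger field as a vector space over the base field\<close>

lemma vector_space_base_scale:
  assumes "field_hom h"
  shows "vector_space (base_scale h)"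
proof -
  interpret field_hom h by fact
  show ?thesis by unfold_locales (simp_all add: base_scale_def algebra_simps hom_distribs)
qed

context
  fixes h :: "'q::field \<Rightarrow> 'a::field"
  assumes h: "field_hom h"
begin

interpretation E: vector_space "base_scale h"
  using h by (rule vector_space_base_scale)

lemma times_mem_span_image:
  assumes "v \<in> E.span T"
  shows "a * v \<in> E.span ((*) a ` T)"
  using assms
proof (induction rule: E.span_induct_alt)
  case base
  show ?case using E.span_zero by simp
next
  case (step c x y)
  have "a * (base_scale h c x + y) = base_scale h c (a * x) + a * y"
    by (simp add: base_scale_def algebra_simps)
  moreover have "a * x \<in> E.span ((*) a ` T)" using step by (intro E.span_base imageI)
  ultimately show ?case using step by (simp add: E.span_add E.span_scale)
qed

lemma rank_weight_eq_dim: "rank_weight h v = E.dim (set\<^sub>v v)"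
  by (simp add: rank_weight_def)

lemma dim_union_le_card_minus_two:
  assumes "finite S" "finite T" and u: "u1 \<in> S" "u2 \<in> S" "u1 \<noteq> u2"
    and "u1 \<in> E.span T" "u2 \<in> E.span T"
  shows "E.dim (S \<union> T) + 2 \<le> card S + card T"
proof -
  let ?W = "(S - {u1, u2}) \<union> T"
  have "S \<union> T \<subseteq> E.span ?W"
  proof
    fix x assume "x \<in> S \<union> T"
    then consider "x = u1" | "x = u2" | "x \<in> ?W" by blast
    then show "x \<in> E.span ?W"
      using assms(6,7) E.span_mono[of T ?W] E.span_base[of x ?W] by cases auto
  qed
  then have "E.dim (S \<union> T) \<le> card ?W"
    using assms(1,2) by (intro E.dim_le_card) auto
  also have "\<dots> \<le> card (S - {u1, u2}) + card T" by (rule card_Un_le)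
  finally have "E.dim (S \<union> T) \<le> card (S - {u1, u2}) + card T" .
  moreover have "card (S - {u1, u2}) = card S - 2"
    using u by (subst card_Diff_subset) auto
  \<comment> \<open>This keeps the natural-number subtraction \<open>card S - 2\<close> from
    truncating.\<close>
  moreover have "card {u1, u2} \<le> card S" using u \<open>finite S\<close> by (intro card_mono) auto
  ultimately show ?thesis using u(3) by simp
qed

text \<open>The direct sum is expressed by counting: \<open>(v, w)\<close> maps injectively to
  \<open>u1 * v - u2 * w\<close> in the field.\<close>

lemma card_span_square_le:
  assumes fin: "finite (UNIV :: 'a set)" and "finite S" "finite T"
    and u: "u1 \<in> S" "u2 \<in> S" "u1 \<noteq> u2" "u1 \<noteq> 0" "u2 \<noteq> 0"
    and weight: "\<And>a. a \<noteq> 0 \<Longrightarrow> card S + card T - 1 \<le> E.dim (S \<union> (*) a ` T)"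
  shows "card (E.span T) ^ 2 \<le> CARD('a)"
proof -
  have no_rel: "v = 0 \<and> w = 0"
    if v: "v \<in> E.span T" and w: "w \<in> E.span T" and eq: "u1 * v = u2 * w" for v w
  proof (rule ccontr)
    assume "\<not> (v = 0 \<and> w = 0)"
    \<comment> \<open>As \<open>u1\<close> and \<open>u2\<close> are nonzero, the relation makes
      \<open>v\<close> vanish exactly when \<open>w\<close> does.\<close>
    then have nz: "v \<noteq> 0" "w \<noteq> 0" using eq u by auto
    define a where "a = u1 / w"
    have a: "a \<noteq> 0" "u1 = a * w" "u2 = a * v"
      using nz u eq by (simp_all add: a_def field_simps)
    have "u1 \<in> E.span ((*) a ` T)" "u2 \<in> E.span ((*) a ` T)"
      using times_mem_span_image[OF w, of a] times_mem_span_image[OF v, of a] a by simp_all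
    then have "E.dim (S \<union> (*) a ` T) + 2 \<le> card S + card ((*) a ` T)"
      using dim_union_le_card_minus_two[OF \<open>finite S\<close> _ u(1-3)] \<open>finite T\<close> by simp
    moreover have "card ((*) a ` T) \<le> card T" using \<open>finite T\<close> by (rule card_image_le)
    ultimately show False using weight[OF a(1)] by linarith
  qed
  have "inj_on (\<lambda>(v, w). u1 * v - u2 * w) (E.span T \<times> E.span T)"
  proof (rule inj_onI, clarify)
    fix v w v' w'
    assume mem: "v \<in> E.span T" "w \<in> E.span T" "v' \<in> E.span T" "w' \<in> E.span T"
      and eq: "u1 * v - u2 * w = u1 * v' - u2 * w'"
    have "u1 * (v - v') = u2 * (w - w')" using eq by (simp add: algebra_simps)
    then show "v = v' \<and> w = w'" using no_rel[of "v - v'" "w - w'"] mem by (simp add: E.span_diff)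
  qed
  then have "card (E.span T \<times> E.span T) \<le> CARD('a)"
    using fin by (intro card_inj_on_le[where f = "\<lambda>(v, w). u1 * v - u2 * w"]) auto
  then show ?thesis by (simp add: card_cartesian_product power2_eq_square)
qed

text \<open>A zero entry adds nothing to the span. Excluding it lets a large rank weight produce
  distinct nonzero entries.\<close>

lemma rank_weight_le_card_nonzero: "rank_weight h v \<le> card (set\<^sub>v v - {0})"
proof -
  have "set\<^sub>v v \<subseteq> E.span (set\<^sub>v v - {0})"
    using E.span_base E.span_zero by fastforce
  then show ?thesis
    unfolding rank_weight_eq_dim by (intro E.dim_le_card) (simp_all add: finite_vec_set)
qed

lemma rank_weight_le_dim_vec: "rank_weight h v \<le> dim_vec v"
  using rank_weight_le_card_nonzero[of v] card_vec_set_le[of v]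
    card_mono[OF finite_vec_set, of "set\<^sub>v v - {0}" v] by simp

end

section \<open>Linear codes and one-dimensional MRD codes\<close>

lemma linear_code_subset_carrier: "linear_code n k C \<Longrightarrow> C \<subseteq> carrier_vec n"
  unfolding linear_code_def VectorSpace.subspace_def submodule_def by (auto simp: module_vec_simps)

lemma linear_code_zero_mem: "linear_code n k C \<Longrightarrow> 0\<^sub>v n \<in> C"
  unfolding linear_code_def VectorSpace.subspace_def submodule_def by (auto simp: module_vec_simps)

lemma linear_code_smult_mem: "linear_code n k C \<Longrightarrow> v \<in> C \<Longrightarrow> a \<cdot>\<^sub>v v \<in> C"
  unfolding linear_code_def VectorSpace.subspace_def submodule_def by (auto simp: module_vec_simps)

lemma linear_code_nonzero_mem:
  assumes "linear_code n k (C :: 'a::field vec set)" and "k \<noteq> 0"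
  obtains v where "v \<in> C" "v \<noteq> 0\<^sub>v n"
proof -
  have "\<not> C \<subseteq> {0\<^sub>v n}"
  proof
    assume "C \<subseteq> {0\<^sub>v n}"
    then have C: "C = {0\<^sub>v n}" using linear_code_zero_mem[OF assms(1)] by blast
    have sub: "VectorSpace.subspace class_ring C (module_vec TYPE('a) n)"
      using assms(1) by (simp add: linear_code_def)
    interpret W: vectorspace class_ring "(module_vec TYPE('a) n)\<lparr>carrier := C\<rparr>"
      using vectorspace.subspace_is_vs[OF _ sub] sub by (simp add: VectorSpace.subspace_def)
    \<comment> \<open>The zero space is generated by the empty set, so its dimension is 0, against
      \<open>k \<noteq> 0\<close>.\<close>
    have "W.gen_set {}" using W.span_empty by (simp add: C module_vec_simps)
    then have "W.dim = 0" using W.gen_ge_dim[of "{}"] by simp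
    then show False using assms by (simp add: linear_code_def)
  qed
  then show thesis using that by blast
qed

text \<open>The weight of \<open>v\<close> is its distance to the zero codeword, hence at least
  \<open>n\<close>; the length bounds it above.\<close>

lemma mrd_code_dim1_rank_weight:
  assumes "field_hom h" and mrd: "mrd_code_dim1 h n C" and v: "v \<in> C" "v \<noteq> 0\<^sub>v n"
  shows "rank_weight h v = n"
proof -
  have lin: "linear_code n 1 C" and min: "min_distance h C = n"
    using mrd by (auto simp: mrd_code_dim1_def)
  have carr: "C \<subseteq> carrier_vec n" by (rule linear_code_subset_carrier[OF lin])
  let ?D = "{rank_weight h (u - v) | u v. u \<in> C \<and> v \<in> C \<and> u \<noteq> v}"
  have "rank_weight h (u - v) \<le> n" if "u \<in> C" "v \<in> C" for u v
    using rank_weight_le_dim_vec[OF assms(1), of "u - v"] carr that by auto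
  then have "?D \<subseteq> {..n}" by auto
  \<comment> \<open>Finiteness is what makes \<open>Min\<close> a lower bound of the
    distances.\<close>
  then have "finite ?D" using finite_subset by blast
  moreover have "rank_weight h (v - 0\<^sub>v n) \<in> ?D" using v linear_code_zero_mem[OF lin] by blast
  moreover have "v - 0\<^sub>v n = v" using v carr by auto
  ultimately have "Min ?D \<le> rank_weight h v" using Min_le[of ?D "rank_weight h v"] by simp
  then have "n \<le> rank_weight h v" using min by (simp add: min_distance_def)
  moreover have "rank_weight h v \<le> n"
    using rank_weight_le_dim_vec[OF assms(1), of v] v carr by auto
  ultimately show ?thesis by simp
qed

section \<open>The bound on the component lengths\<close>

lemma mrd_pair_length_le_half:
  fixes h :: "'q::{field,finite} \<Rightarrow> 'a::{field,finite}"
  assumes hom: "field_hom h" and card: "CARD('a) = CARD('q) ^ m" and "1 < n1"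
    and C1: "mrd_code_dim1 h n1 C1" and C2: "mrd_code_dim1 h n2 C2"
    and weight: "\<And>c1 c2. c1 \<in> C1 \<Longrightarrow> c2 \<in> C2 \<Longrightarrow> c1 \<noteq> 0\<^sub>v n1 \<Longrightarrow> c2 \<noteq> 0\<^sub>v n2 \<Longrightarrow>
      n1 + n2 - 1 \<le> rank_weight h (c1 @\<^sub>v c2)"
  shows "2 * n2 \<le> m"
proof -
  interpret E: vector_space "base_scale h" using hom by (rule vector_space_base_scale)
  have lin1: "linear_code n1 1 C1" and lin2: "linear_code n2 1 C2"
    using C1 C2 by (auto simp: mrd_code_dim1_def)
  obtain c where c: "c \<in> C1" "c \<noteq> 0\<^sub>v n1" using linear_code_nonzero_mem[OF lin1] by auto
  obtain d where d: "d \<in> C2" "d \<noteq> 0\<^sub>v n2" using linear_code_nonzero_mem[OF lin2] by auto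
  have dims: "dim_vec c = n1" "dim_vec d = n2"
    using c d linear_code_subset_carrier[OF lin1] linear_code_subset_carrier[OF lin2] by auto
  have "n1 \<le> card (set\<^sub>v c - {0})"
    using rank_weight_le_card_nonzero[OF hom, of c] mrd_code_dim1_rank_weight[OF hom C1 c] by simp
  then have "\<not> card (set\<^sub>v c - {0}) \<le> 1" using \<open>1 < n1\<close> by simp
  then obtain u1 u2 where u: "u1 \<in> set\<^sub>v c - {0}" "u2 \<in> set\<^sub>v c - {0}" "u1 \<noteq> u2"
    using card_le_Suc0_iff_eq[of "set\<^sub>v c - {0}"] finite_vec_set[of c] by auto
  have "card (E.span (set\<^sub>v d)) ^ 2 \<le> CARD('a)"
  proof (rule card_span_square_le[OF hom, where S = "set\<^sub>v c" and ?u1.0 = u1 and ?u2.0 = u2])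
    fix a :: 'a assume a: "a \<noteq> 0"
    have "a \<cdot>\<^sub>v d \<noteq> 0\<^sub>v n2"
    proof
      assume "a \<cdot>\<^sub>v d = 0\<^sub>v n2"
      then have "inverse a \<cdot>\<^sub>v (a \<cdot>\<^sub>v d) = 0\<^sub>v n2" by auto
      then show False using a d(2) by (simp add: smult_smult_assoc)
    qed
    then have "n1 + n2 - 1 \<le> rank_weight h (c @\<^sub>v (a \<cdot>\<^sub>v d))"
      using c d linear_code_smult_mem[OF lin2] by (intro weight) auto
    then have "n1 + n2 - 1 \<le> E.dim (set\<^sub>v c \<union> (*) a ` set\<^sub>v d)"
      by (simp add: rank_weight_eq_dim[OF hom] vec_set_append vec_set_smult)
    \<comment> \<open>Entry sets have at most as many elements as the vectors have positions, so the
      bound by lengths is the stronger one.\<close>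
    then show "card (set\<^sub>v c) + card (set\<^sub>v d) - 1 \<le> E.dim (set\<^sub>v c \<union> (*) a ` set\<^sub>v d)"
      using card_vec_set_le[of c] card_vec_set_le[of d] dims by linarith
  qed (use u finite_vec_set in auto)
  moreover have "E.dim (set\<^sub>v d) = n2"
    using mrd_code_dim1_rank_weight[OF hom C2 d] by (simp add: rank_weight_eq_dim[OF hom])
  ultimately have "CARD('q) ^ (2 * n2) \<le> CARD('q) ^ m"
    using card by (simp add: E.card_span finite_vec_set power_mult[symmetric] mult.commute)
  \<comment> \<open>With a base above 1, the exponents \<open>2 * n2\<close> and \<open>m\<close>
    can be compared.\<close>
  moreover have "1 < CARD('q)"
    using card_mono[of "UNIV :: 'q set" "{0, 1}"] by simp
  ultimately show ?thesis by simp
qed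

theorem theorem2p31:
  fixes h :: "'q::{field,finite} \<Rightarrow> 'a::{field,finite}"
    and q m n1 n2 :: nat
  assumes "field_hom h"
    and "CARD('q) = q" and "CARD('a) = q ^ m"
    and "1 < n1" and "n1 \<le> m" and "1 < n2" and "n2 \<le> m"
    and "\<exists>C. mrd_code_11 h n1 n2 C"
  shows "real n1 \<le> real m / 2 \<and> real n2 \<le> real m / 2 \<and>
    (n1 = n2 \<longrightarrow>
       m \<ge> n1 + n2 \<and>
       (m = n1 + n2 \<longleftrightarrow> real n1 = real m / 2 \<and> real n2 = real m / 2)) \<and>
    (n1 \<noteq> n2 \<longrightarrow> m \<ge> n1 + n2 + 1)"
proof -
  obtain C1 C2 where C: "mrd_code_dim1 h n1 C1" "mrd_code_dim1 h n2 C2"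
    and weight: "\<And>c1 c2. c1 \<in> C1 \<Longrightarrow> c2 \<in> C2 \<Longrightarrow> c1 \<noteq> 0\<^sub>v n1 \<Longrightarrow> c2 \<noteq> 0\<^sub>v n2 \<Longrightarrow>
      n1 + n2 - 1 \<le> rank_weight h (c1 @\<^sub>v c2)"
    using assms(8) unfolding mrd_code_11_def by blast
  have card: "CARD('a) = CARD('q) ^ m" using assms(2,3) by simp
  \<comment> \<open>Rank weight depends only on the entry set, so the two blocks can exchange roles
    and both lengths get bounded.\<close>
  have "rank_weight h (c2 @\<^sub>v c1) = rank_weight h (c1 @\<^sub>v c2)" for c1 c2
    by (simp add: rank_weight_def vec_set_append Un_commute)
  then have weight': "n2 + n1 - 1 \<le> rank_weight h (c2 @\<^sub>v c1)"
    if "c2 \<in> C2" "c1 \<in> C1" "c2 \<noteq> 0\<^sub>v n2" "c1 \<noteq> 0\<^sub>v n1" for c1 c2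
    using weight[OF that(2,1,4,3)] by (simp add: add.commute)
  have "2 * n2 \<le> m"
    by (rule mrd_pair_length_le_half[OF assms(1) card assms(4) C weight])
  moreover have "2 * n1 \<le> m"
    by (rule mrd_pair_length_le_half[OF assms(1) card assms(6) C(2,1) weight'])
  \<comment> \<open>For \<open>n1 \<noteq> n2\<close>, twice the larger length already exceeds
    \<open>n1 + n2\<close> by at least 1.\<close>
  ultimately show ?thesis by linarith
qed

end
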